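(* Let $G$ be a sandpile graph with nonsink vertices $v_1,\dots,v_n$, and fix a sandpile monomial ordering on $R=\mathbb{C}[x_1,\dots,x_n]$, with vertices numbered so that $x_i>x_j$ if $i<j$. Let $b$ be a burning configuration on $G$ and let $\sigma_b$ be its script. Then $$\Gamma_b=\{\mathcal{T}(\sigma): \sigma\in\mathbb{Z}\widetilde V,\ 0\le\sigma\le\sigma_b\}$$ is a Gröbner basis for the toppling ideal $I(G)$ with respect to the sandpile monomial ordering.
   Context: A directed multigraph $G=(V,E)$ has a finite vertex set $V$ and edge set $E\subseteq V\times V$ with a weight function $\mathrm{wt}:V\times V\to\mathbb{N}$, $\mathrm{wt}(u,v)>0$ iff $(u,v)\in E$ (loops allowed); $\mathrm{outdeg}(v)=\sum_{u\in V}\mathrm{wt}(v,u)$. A sandpile graph $(V,E,s)$ is a directed multigraph with a vertex $s$ (the sink) that is globally accessible: from every vertex there is a directed path to $s$. Write $V=\{v_1,\dots,v_{n+1}\}$, $s=v_{n+1}$, $\widetilde V=V\setminus\{s\}$, $\mathbb{Z}\widetilde V\cong\mathbb{Z}^n$. The reduced Laplacian is $\widetilde\Delta:\mathbb{Z}\widetilde V\to\mathbb{Z}\widetilde V$, $\widetilde\Delta(v)=\mathrm{outdeg}(v)\,v-\sum_{u\in\widetilde V}\mathrm{wt}(v,u)\,u$ (it is injective); $\widetilde{\mathcal{L}}=\mathrm{im}(\widetilde\Delta)$. The toppling ideal is $I(G)=\mathrm{Span}_{\mathbb{C}}\{x^u-x^v:u,v\in\mathbb{N}^n,\ u-v\in\widetilde{\mathcal{L}}\}\subseteq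 R$. Inequalities in $\mathbb{Z}\widetilde V$ are coordinatewise. A burning configuration is $b\in\mathbb{Z}\widetilde V$ such that (1) $b\in\widetilde{\mathcal{L}}$; (2) $b\ge 0$; (3) for every $v\in\widetilde V$ there is a directed path (possibly of length $0$), through nonsink vertices, to $v$ from some element of $\mathrm{supp}(b)=\{u:b_u\ne0\}$. Its script is $\sigma_b=\widetilde\Delta^{-1}b$. For $\ell\in\mathbb{Z}\widetilde V$ write $\ell=\ell^+-\ell^-$ with $\ell^\pm\ge0$ of disjoint support. Define $\mathcal{T}:\mathbb{Z}\widetilde V\to R$ by $\mathcal{T}(\sigma)=x^{\ell^+}-x^{\ell^-}$ where $\ell=\widetilde\Delta\sigma$. A sandpile monomial ordering on $R$ is a degree reverse lexicographic ordering, for an ordering of the indeterminates in which $x_i>x_j$ whenever the shortest directed path from $v_j$ to the sink is strictly shorter than that from $v_i$ (ties ordered arbitrarily). With indeterminates ordered $x_1>\dots>x_n$, degree reverse lexicographic order is: $x^a>x^{a'}$ if $\deg a>\deg a'$, or $\deg a=\deg a'$ and the right-most nonzero entry of $a-a'$ is negative. A finite subset $\Gamma\subseteq I$ is a Gröbner basis of $I$ if for every nonzero $f\in I$ the leading term of some nonzero $g\in\Gamma$ divides the leading term of $f$. *)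

theory Defs
  imports Complex_Main "HOL-Library.Poly_Mapping"
begin

section \<open>Polynomials\<close>

text \<open>
  An exponent vector is a finitely supported map \<open>'v \<Rightarrow>\<^sub>0 nat\<close>, and a polynomial is a finitely
  supported map from exponent vectors to coefficients; ring multiplication is the convolution
  product of the library. The indeterminates are indexed by the vertices themselves, so that the
  variable \<open>x\<^sub>i\<close> is the one indexed by \<open>v\<^sub>i\<close>. The type contains indeterminates for all elements of
  \<open>'v\<close>; the ring in the nonsink vertices consists of the polynomials in which only those occur.
\<close>

type_synonym 'v expo = "'v \<Rightarrow>\<^sub>0 nat"
type_synonym 'v mpol = "'v expo \<Rightarrow>\<^sub>0 complex"

definition xpow :: "'v expo \<Rightarrow> 'v mpol" where
  "xpow u = Poly_Mapping.single u 1"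

global_interpretation mpol: vector_space
  "\<lambda>(c::complex) (p::'v mpol). Poly_Mapping.map ((*) c) p"
  by unfold_locales
    (auto intro!: poly_mapping_eqI simp: map.rep_eq lookup_add when_def algebra_simps
          simp flip: distrib_left)

definition total_degree :: "'v expo \<Rightarrow> nat" where
  "total_degree a = (\<Sum>k\<in>Poly_Mapping.keys a. Poly_Mapping.lookup a k)"

text \<open>
  Degree reverse lexicographic order for the indeterminates indexed by \<open>v 1, \<dots>, v n\<close>, with
  \<open>v 1\<close> the largest. If the right-most nonzero entry of \<open>a' - a\<close> is at position \<open>k\<close>, it is negative
  exactly if \<open>a' < a\<close> there.
\<close>

definition degrevlex_less :: "(nat \<Rightarrow> 'v) \<Rightarrow> nat \<Rightarrow> 'v expo \<Rightarrow> 'v expo \<Rightarrow> bool" where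
  "degrevlex_less v n a a' \<longleftrightarrow>
     total_degree a < total_degree a' \<or>
     total_degree a = total_degree a' \<and>
     (\<exists>k\<in>{1..n}. Poly_Mapping.lookup a' (v k) < Poly_Mapping.lookup a (v k) \<and>
        (\<forall>j\<in>{k<..n}. Poly_Mapping.lookup a' (v j) = Poly_Mapping.lookup a (v j)))"

text \<open>The leading exponent is only meaningful for nonzero polynomials.\<close>

definition leading_expo :: "('v expo \<Rightarrow> 'v expo \<Rightarrow> bool) \<Rightarrow> 'v mpol \<Rightarrow> 'v expo" where
  "leading_expo lt p =
     (THE m. m \<in> Poly_Mapping.keys p \<and> (\<forall>m'\<in>Poly_Mapping.keys p. m' \<noteq> m \<longrightarrow> lt m' m))"

definition leading_term :: "('v expo \<Rightarrow> 'v expo \<Rightarrow> bool) \<Rightarrow> 'v mpol \<Rightarrow> 'v mpol" where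
  "leading_term lt p =
     Poly_Mapping.single (leading_expo lt p) (Poly_Mapping.lookup p (leading_expo lt p))"

text \<open>
  Divisibility of a term by a nonzero term does not depend on which further indeterminates the ring
  contains, since the quotient involves only indeterminates of the dividend.
\<close>

definition groebner_basis ::
    "('v expo \<Rightarrow> 'v expo \<Rightarrow> bool) \<Rightarrow> 'v mpol set \<Rightarrow> 'v mpol set \<Rightarrow> bool" where
  "groebner_basis lt \<Gamma> I \<longleftrightarrow>
     finite \<Gamma> \<and> \<Gamma> \<subseteq> I \<and>
     (\<forall>f\<in>I. f \<noteq> 0 \<longrightarrow> (\<exists>g\<in>\<Gamma>. g \<noteq> 0 \<and> leading_term lt g dvd leading_term lt f))"


section \<open>Sandpile graphs\<close>

record 'v multigraph =
  verts :: "'v set"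
  edges :: "('v \<times> 'v) set"
  wt :: "'v \<Rightarrow> 'v \<Rightarrow> nat"

record 'v sandpile = "'v multigraph" +
  sink :: 'v

text \<open>The values of the weight function outside \<open>V \<times> V\<close> are irrelevant throughout.\<close>

definition directed_multigraph :: "('v, 'm) multigraph_scheme \<Rightarrow> bool" where
  "directed_multigraph G \<longleftrightarrow>
     finite (verts G) \<and> edges G \<subseteq> verts G \<times> verts G \<and>
     (\<forall>u\<in>verts G. \<forall>v\<in>verts G. wt G u v > 0 \<longleftrightarrow> (u, v) \<in> edges G)"

definition outdeg :: "('v, 'm) multigraph_scheme \<Rightarrow> 'v \<Rightarrow> nat" where
  "outdeg G v = (\<Sum>u\<in>verts G. wt G v u)"

definition sandpile_graph :: "'v sandpile \<Rightarrow> bool" where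
  "sandpile_graph G \<longleftrightarrow>
     directed_multigraph G \<and> sink G \<in> verts G \<and>
     (\<forall>v\<in>verts G. (v, sink G) \<in> (edges G)\<^sup>*)"

definition nonsink :: "'v sandpile \<Rightarrow> 'v set" where
  "nonsink G = verts G - {sink G}"

definition configs :: "'v sandpile \<Rightarrow> ('v \<Rightarrow>\<^sub>0 int) set" where
  "configs G = {c. Poly_Mapping.keys c \<subseteq> nonsink G}"

text \<open>
  The order \<open>\<le>\<close> that the library puts on \<^typ>\<open>'a \<Rightarrow>\<^sub>0 int\<close> for linearly ordered index types is
  lexicographic, hence a separate constant.
\<close>

definition coord_le :: "('v \<Rightarrow>\<^sub>0 int) \<Rightarrow> ('v \<Rightarrow>\<^sub>0 int) \<Rightarrow> bool" where
  "coord_le c d \<longleftrightarrow> (\<forall>v. Poly_Mapping.lookup c v \<le> Poly_Mapping.lookup d v)"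

text \<open>\<^const>\<open>frag_extend\<close> extends a map given on the generators linearly.\<close>

definition reduced_laplacian :: "'v sandpile \<Rightarrow> ('v \<Rightarrow>\<^sub>0 int) \<Rightarrow> ('v \<Rightarrow>\<^sub>0 int)" where
  "reduced_laplacian G =
     frag_extend (\<lambda>v. frag_cmul (int (outdeg G v)) (frag_of v)
                       - (\<Sum>u\<in>nonsink G. frag_cmul (int (wt G v u)) (frag_of u)))"

definition laplacian_lattice :: "'v sandpile \<Rightarrow> ('v \<Rightarrow>\<^sub>0 int) set" where
  "laplacian_lattice G = reduced_laplacian G ` configs G"

definition toppling_ideal :: "'v sandpile \<Rightarrow> 'v mpol set" where
  "toppling_ideal G =
     mpol.span {xpow u - xpow w | u w.
       Poly_Mapping.keys u \<subseteq> nonsink G \<and> Poly_Mapping.keys w \<subseteq> nonsink G \<and>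
       Poly_Mapping.map int u - Poly_Mapping.map int w \<in> laplacian_lattice G}"

definition burning_config :: "'v sandpile \<Rightarrow> ('v \<Rightarrow>\<^sub>0 int) \<Rightarrow> bool" where
  "burning_config G b \<longleftrightarrow>
     b \<in> laplacian_lattice G \<and> coord_le 0 b \<and>
     (\<forall>v\<in>nonsink G. \<exists>u\<in>Poly_Mapping.keys b.
        (u, v) \<in> (edges G \<inter> nonsink G \<times> nonsink G)\<^sup>*)"

definition script :: "'v sandpile \<Rightarrow> ('v \<Rightarrow>\<^sub>0 int) \<Rightarrow> ('v \<Rightarrow>\<^sub>0 int)" where
  "script G b = inv_into (configs G) (reduced_laplacian G) b"

text \<open>The exponents of the two monomials are the positive and negative parts of \<open>l\<close>.\<close>

definition toppling_binomial :: "'v sandpile \<Rightarrow> ('v \<Rightarrow>\<^sub>0 int) \<Rightarrow> 'v mpol" where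
  "toppling_binomial G \<sigma> =
     (let l = reduced_laplacian G \<sigma>
      in xpow (Poly_Mapping.map nat l) - xpow (Poly_Mapping.map nat (- l)))"

definition sink_distance :: "'v sandpile \<Rightarrow> 'v \<Rightarrow> nat" where
  "sink_distance G v = (LEAST k. (v, sink G) \<in> edges G ^^ k)"

text \<open>
  A numbering \<open>v 1, \<dots>, v n\<close> of the nonsink vertices, with \<open>x\<^sub>i > x\<^sub>j\<close> for \<open>i < j\<close>, for which
  \<^term>\<open>degrevlex_less v n\<close> is a sandpile monomial ordering.
\<close>

definition sandpile_numbering :: "'v sandpile \<Rightarrow> (nat \<Rightarrow> 'v) \<Rightarrow> nat \<Rightarrow> bool" where
  "sandpile_numbering G v n \<longleftrightarrow>
     bij_betw v {1..n} (nonsink G) \<and>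
     (\<forall>i\<in>{1..n}. \<forall>j\<in>{1..n}. sink_distance G (v j) < sink_distance G (v i) \<longrightarrow> i < j)"

end

theory Submission
  imports Defs
begin

text \<open>
  Write \<open>\<Delta>\<close> for the reduced Laplacian and \<open>L\<close> for its image. The proof is an argument about firing
  scripts \<open>\<sigma> \<ge> 0\<close>, in three steps.

  \<^item> Firing decreases monomials: if \<open>a' - a = \<Delta> \<sigma>\<close> with \<open>\<sigma> \<ge> 0\<close> nonzero, then \<open>x\<^sup>a < x\<^sup>a\<^sup>'\<close>
    (\<open>firing_decreases\<close>). Firing never creates sand. If it loses none to the sink, some vertex
    strictly closer to the sink than all fired vertices gains sand, and the ordering makes
    exactly this smaller. Hence the leading monomial of the binomial of such a \<open>\<sigma>\<close> is the one
    whose exponent is the positive part of \<open>\<Delta> \<sigma>\<close>, and it divides \<open>x\<^sup>u\<close> precisely if \<open>u \<ge> \<Delta> \<sigma>\<close>, that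
    is, if \<open>\<sigma>\<close> can be fired from \<open>u\<close> without making an entry negative.

  \<^item> A legal script remains legal if its negative entries are replaced by zero: if \<open>u \<ge> 0\<close> and
    \<open>u \<ge> \<Delta> \<tau>\<close>, then \<open>u \<ge> \<Delta> \<tau>\<^sup>+\<close> (\<open>legal_positive_part\<close>). With \<open>u = 0\<close> and the first step this
    shows that \<open>\<Delta> \<sigma> \<ge> 0\<close> forces \<open>\<sigma> \<ge> 0\<close>, and then that the script of a burning configuration is
    positive everywhere (\<open>script_pos\<close>). Since \<open>b \<ge> 0\<close>, subtracting the script \<open>\<sigma>\<^sub>b\<close> of \<open>b\<close> from a legal script keeps it
    legal, so \<open>\<sigma>\<close> may be replaced by \<open>(\<sigma> - \<sigma>\<^sub>b)\<^sup>+\<close>, which is strictly smaller. The last nonzero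
    script so obtained lies below \<open>\<sigma>\<^sub>b\<close> (\<open>legal_script_below_burning_script\<close>).

  \<^item> The coefficients of an element \<open>f\<close> of the toppling ideal add up to zero over every class of
    exponents modulo \<open>L\<close>. The leading exponent \<open>m\<close> of \<open>f\<close> is therefore equivalent to another
    exponent \<open>m' < m\<close> of \<open>f\<close> (\<open>toppling_ideal_equivalent_exponent\<close>).

  Now write \<open>m - m' = \<Delta> \<tau>\<close>. The script \<open>\<tau>\<close> is legal for \<open>m\<close> because \<open>m' \<ge> 0\<close>, hence so is \<open>\<tau>\<^sup>+\<close>. It
  is nonzero, since otherwise \<open>m'\<close> would fire to \<open>m\<close> by \<open>- \<tau> \<ge> 0\<close>, and \<open>m\<close> would be the
  smaller one. So there is a nonzero legal script below \<open>\<sigma>\<^sub>b\<close>, and the leading monomial of its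
  binomial divides \<open>x\<^sup>m\<close>.
\<close>

section \<open>The reduced Laplacian\<close>

lemma lookup_map_zero:
  "f 0 = 0 \<Longrightarrow> Poly_Mapping.lookup (Poly_Mapping.map f p) x = f (Poly_Mapping.lookup p x)"
  by (simp add: map.rep_eq when_def)

lemma keys_map_subset: "Poly_Mapping.keys (Poly_Mapping.map f p) \<subseteq> Poly_Mapping.keys p"
  by (auto simp: in_keys_iff map.rep_eq when_def)

lemma finite_nonsink: "sandpile_graph G \<Longrightarrow> finite (nonsink G)"
  by (simp add: sandpile_graph_def directed_multigraph_def nonsink_def)

lemma lookup_reduced_laplacian:
  assumes G: "sandpile_graph G" and s: "\<sigma> \<in> configs G"
  shows "Poly_Mapping.lookup (reduced_laplacian G \<sigma>) x =
    (if x \<in> nonsink G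
     then int (outdeg G x) * Poly_Mapping.lookup \<sigma> x
          - (\<Sum>y\<in>nonsink G. int (wt G y x) * Poly_Mapping.lookup \<sigma> y)
     else 0)"
proof -
  let ?N = "nonsink G"
  let ?s = "Poly_Mapping.lookup \<sigma>"
  have fin: "finite ?N" by (rule finite_nonsink[OF G])
  have row: "(\<Sum>u\<in>?N. int (wt G y u) * Poly_Mapping.lookup (frag_of u) x)
      = (if x \<in> ?N then int (wt G y x) else 0)" for y
    using fin by (simp add: lookup_single when_def if_distrib cong: if_cong)
  have "Poly_Mapping.lookup (reduced_laplacian G \<sigma>) x =
      (\<Sum>y\<in>Poly_Mapping.keys \<sigma>. ?s y *
        ((if x = y then int (outdeg G y) else 0) - (if x \<in> ?N then int (wt G y x) else 0)))"
    unfolding reduced_laplacian_def frag_extend_def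
    by (simp only: lookup_sum lookup_frag_cmul lookup_minus row)
       (auto intro!: sum.cong simp: lookup_single when_def)
  also have "\<dots> = (\<Sum>y\<in>?N. ?s y *
        ((if x = y then int (outdeg G y) else 0) - (if x \<in> ?N then int (wt G y x) else 0)))"
    using s fin by (intro sum.mono_neutral_left) (auto simp: configs_def in_keys_iff)
  also have "\<dots> = (\<Sum>y\<in>?N. if x = y then int (outdeg G y) * ?s y else 0)
       - (\<Sum>y\<in>?N. if x \<in> ?N then int (wt G y x) * ?s y else 0)"
    unfolding sum_subtractf[symmetric] by (intro sum.cong) (auto simp: algebra_simps)
  finally show ?thesis using fin by auto
qed

lemma configs_closed:
  "0 \<in> configs G"
  "c \<in> configs G \<Longrightarrow> - c \<in> configs G"
  "c \<in> configs G \<Longrightarrow> d \<in> configs G \<Longrightarrow> c + d \<in> configs G"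
  "c \<in> configs G \<Longrightarrow> d \<in> configs G \<Longrightarrow> c - d \<in> configs G"
  "c \<in> configs G \<Longrightarrow> Poly_Mapping.map f c \<in> configs G"
  using keys_map_subset[of f c] Poly_Mapping.keys_add[of c d] keys_diff[of c d]
  by (auto simp: configs_def)

lemma reduced_laplacian_linear:
  "reduced_laplacian G 0 = 0"
  "reduced_laplacian G (- c) = - reduced_laplacian G c"
  "reduced_laplacian G (c + d) = reduced_laplacian G c + reduced_laplacian G d"
  "reduced_laplacian G (c - d) = reduced_laplacian G c - reduced_laplacian G d"
  unfolding reduced_laplacian_def
  by (simp_all only: frag_extend_0 frag_extend_minus frag_extend_add frag_extend_diff)

lemma lattice_closed:
  "0 \<in> laplacian_lattice G"
  "l \<in> laplacian_lattice G \<Longrightarrow> - l \<in> laplacian_lattice G"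
  "l \<in> laplacian_lattice G \<Longrightarrow> l' \<in> laplacian_lattice G \<Longrightarrow> l + l' \<in> laplacian_lattice G"
  unfolding laplacian_lattice_def image_iff Bex_def
  by (metis configs_closed(1) reduced_laplacian_linear(1),
      metis configs_closed(2) reduced_laplacian_linear(2),
      metis configs_closed(3) reduced_laplacian_linear(3))

section \<open>The degree reverse lexicographic order\<close>

lemma degrevlex_less_asym:
  assumes "degrevlex_less v n a a'"
  shows "\<not> degrevlex_less v n a' a"
proof
  let ?P = "\<lambda>a a' k. Poly_Mapping.lookup a' (v k) < Poly_Mapping.lookup a (v k) \<and>
    (\<forall>j\<in>{k<..n}. Poly_Mapping.lookup a' (v j) = Poly_Mapping.lookup a (v j))"
  assume "degrevlex_less v n a' a"
  with assms have "\<exists>k\<in>{1..n}. ?P a a' k" "\<exists>l\<in>{1..n}. ?P a' a l"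
    unfolding degrevlex_less_def by linarith+
  then obtain k l where k: "k \<in> {1..n}" "?P a a' k" and l: "l \<in> {1..n}" "?P a' a l" by blast
  have "l \<notin> {k<..n}" "k \<notin> {l<..n}" using k(2) l(2) by (metis less_irrefl)+
  with k(1) l(1) have "k = l" by simp
  with k(2) l(2) show False by (metis less_asym)
qed

lemma degrevlex_less_trans:
  assumes "degrevlex_less v n a b" "degrevlex_less v n b c"
  shows "degrevlex_less v n a c"
proof (cases "total_degree a = total_degree b \<and> total_degree b = total_degree c")
  case False
  then show ?thesis using assms unfolding degrevlex_less_def by auto
next
  case True
  with assms obtain k l where k: "k \<in> {1..n}"
      "Poly_Mapping.lookup b (v k) < Poly_Mapping.lookup a (v k)"
      "\<forall>j\<in>{k<..n}. Poly_Mapping.lookup b (v j) = Poly_Mapping.lookup a (v j)"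
    and l: "l \<in> {1..n}" "Poly_Mapping.lookup c (v l) < Poly_Mapping.lookup b (v l)"
      "\<forall>j\<in>{l<..n}. Poly_Mapping.lookup c (v j) = Poly_Mapping.lookup b (v j)"
    unfolding degrevlex_less_def by auto
  have "max k l \<in> {1..n}" using k l by auto
  moreover have "Poly_Mapping.lookup c (v (max k l)) < Poly_Mapping.lookup a (v (max k l))"
    using k l by (cases k l rule: linorder_cases) auto
  moreover have "\<forall>j\<in>{max k l<..n}. Poly_Mapping.lookup c (v j) = Poly_Mapping.lookup a (v j)"
    using k l by auto
  ultimately show ?thesis using True unfolding degrevlex_less_def by (intro disjI2) auto
qed

lemma degrevlex_less_total:
  assumes bij: "bij_betw v {1..n} N"
    and a: "Poly_Mapping.keys a \<subseteq> N" and a': "Poly_Mapping.keys a' \<subseteq> N" and ne: "a \<noteq> a'"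
  shows "degrevlex_less v n a a' \<or> degrevlex_less v n a' a"
proof -
  define K where "K = {k\<in>{1..n}. Poly_Mapping.lookup a (v k) \<noteq> Poly_Mapping.lookup a' (v k)}"
  obtain x where x: "Poly_Mapping.lookup a x \<noteq> Poly_Mapping.lookup a' x"
    using ne by (metis poly_mapping_eqI)
  then have "x \<in> Poly_Mapping.keys a \<union> Poly_Mapping.keys a'" by (auto simp: in_keys_iff)
  then have "x \<in> v ` {1..n}" using bij a a' by (auto simp: bij_betw_def)
  then have K: "finite K" "K \<noteq> {}" using x by (auto simp: K_def)
  define k where "k = Max K"
  have k: "k \<in> {1..n}" "Poly_Mapping.lookup a (v k) \<noteq> Poly_Mapping.lookup a' (v k)"
    using Max_in[OF K] by (auto simp: k_def K_def)
  have above: "\<forall>j\<in>{k<..n}. Poly_Mapping.lookup a (v j) = Poly_Mapping.lookup a' (v j)"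
  proof
    fix j assume j: "j \<in> {k<..n}"
    then have "j \<notin> K" using Max_ge[OF K(1), of j] by (auto simp: k_def)
    with j k(1) show "Poly_Mapping.lookup a (v j) = Poly_Mapping.lookup a' (v j)"
      by (auto simp: K_def)
  qed
  from k(2) consider "Poly_Mapping.lookup a (v k) < Poly_Mapping.lookup a' (v k)"
    | "Poly_Mapping.lookup a' (v k) < Poly_Mapping.lookup a (v k)" by linarith
  then have "(\<exists>k\<in>{1..n}. Poly_Mapping.lookup a' (v k) < Poly_Mapping.lookup a (v k) \<and>
      (\<forall>j\<in>{k<..n}. Poly_Mapping.lookup a' (v j) = Poly_Mapping.lookup a (v j))) \<or>
    (\<exists>k\<in>{1..n}. Poly_Mapping.lookup a (v k) < Poly_Mapping.lookup a' (v k) \<and>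
      (\<forall>j\<in>{k<..n}. Poly_Mapping.lookup a (v j) = Poly_Mapping.lookup a' (v j)))"
    using k(1) above by cases (rule disjI2, force, rule disjI1, force)
  then show ?thesis unfolding degrevlex_less_def by linarith
qed

lemma leading_expo_eqI:
  assumes "m \<in> Poly_Mapping.keys p"
    and "\<And>m'. m' \<in> Poly_Mapping.keys p \<Longrightarrow> m' \<noteq> m \<Longrightarrow> degrevlex_less v n m' m"
  shows "leading_expo (degrevlex_less v n) p = m"
  unfolding leading_expo_def
proof (rule the_equality)
  fix m' assume m': "m' \<in> Poly_Mapping.keys p \<and>
    (\<forall>m''\<in>Poly_Mapping.keys p. m'' \<noteq> m' \<longrightarrow> degrevlex_less v n m'' m')"
  show "m' = m"
  proof (rule ccontr)
    assume "m' \<noteq> m"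
    then have "degrevlex_less v n m' m" "degrevlex_less v n m m'" using assms m' by auto
    then show False using degrevlex_less_asym by metis
  qed
qed (simp add: assms)

lemma leading_expo_max:
  assumes bij: "bij_betw v {1..n} N" and nz: "p \<noteq> 0"
    and supp: "\<And>m. m \<in> Poly_Mapping.keys p \<Longrightarrow> Poly_Mapping.keys m \<subseteq> N"
  shows "leading_expo (degrevlex_less v n) p \<in> Poly_Mapping.keys p"
    and "m' \<in> Poly_Mapping.keys p \<Longrightarrow> m' \<noteq> leading_expo (degrevlex_less v n) p \<Longrightarrow>
           degrevlex_less v n m' (leading_expo (degrevlex_less v n) p)"
proof -
  have "\<exists>m\<in>A. \<forall>m'\<in>A. m' \<noteq> m \<longrightarrow> degrevlex_less v n m' m"
    if "finite A" "A \<noteq> {}" "A \<subseteq> Poly_Mapping.keys p" for A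
    using that
  proof (induction rule: finite_ne_induct)
    case (singleton x)
    then show ?case by simp
  next
    case (insert x A)
    then obtain m where m: "m \<in> A"
      "\<And>m'. m' \<in> A \<Longrightarrow> m' \<noteq> m \<Longrightarrow> degrevlex_less v n m' m" by auto
    have "x \<noteq> m" "Poly_Mapping.keys x \<subseteq> N" "Poly_Mapping.keys m \<subseteq> N"
      using m(1) insert.hyps insert.prems supp by blast+
    then consider "degrevlex_less v n x m" | "degrevlex_less v n m x"
      using degrevlex_less_total[OF bij] by metis
    then show ?case
    proof cases
      case 1
      with m show ?thesis by (intro bexI[of _ m]) auto
    next
      case 2
      with m show ?thesis
        by (intro bexI[of _ x]) (auto intro: degrevlex_less_trans[OF _ 2])
    qed
  qed
  from this[of "Poly_Mapping.keys p"] nz obtain m where m: "m \<in> Poly_Mapping.keys p"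
    "\<forall>m'\<in>Poly_Mapping.keys p. m' \<noteq> m \<longrightarrow> degrevlex_less v n m' m" by auto
  then have e: "leading_expo (degrevlex_less v n) p = m" by (intro leading_expo_eqI) auto
  show "leading_expo (degrevlex_less v n) p \<in> Poly_Mapping.keys p"
    and "m' \<in> Poly_Mapping.keys p \<Longrightarrow> m' \<noteq> leading_expo (degrevlex_less v n) p \<Longrightarrow>
           degrevlex_less v n m' (leading_expo (degrevlex_less v n) p)"
    using m unfolding e by auto
qed

section \<open>Firing and the sandpile ordering\<close>

text \<open>
  The total of \<open>\<Delta> \<sigma>\<close> is the amount of sand that firing \<open>\<sigma>\<close> sends into the sink: everything else that
  leaves a vertex arrives at another nonsink vertex.
\<close>

lemma sum_reduced_laplacian:
  assumes G: "sandpile_graph G" and s: "\<sigma> \<in> configs G"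
  shows "(\<Sum>x\<in>nonsink G. Poly_Mapping.lookup (reduced_laplacian G \<sigma>) x) =
    (\<Sum>y\<in>nonsink G. int (wt G y (sink G)) * Poly_Mapping.lookup \<sigma> y)"
proof -
  let ?N = "nonsink G"
  let ?s = "Poly_Mapping.lookup \<sigma>"
  have fin: "finite (verts G)" and sk: "sink G \<in> verts G"
    using G by (auto simp: sandpile_graph_def directed_multigraph_def)
  have od: "int (outdeg G y) = int (wt G y (sink G)) + (\<Sum>x\<in>?N. int (wt G y x))" for y
    unfolding outdeg_def nonsink_def using sum.remove[OF fin sk, of "wt G y"] by simp
  have "(\<Sum>x\<in>?N. Poly_Mapping.lookup (reduced_laplacian G \<sigma>) x)
      = (\<Sum>y\<in>?N. int (outdeg G y) * ?s y) - (\<Sum>x\<in>?N. \<Sum>y\<in>?N. int (wt G y x) * ?s y)"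
    by (simp add: lookup_reduced_laplacian[OF G s] sum_subtractf)
  also have "(\<Sum>x\<in>?N. \<Sum>y\<in>?N. int (wt G y x) * ?s y)
      = (\<Sum>y\<in>?N. (\<Sum>x\<in>?N. int (wt G y x)) * ?s y)"
    by (subst sum.swap) (simp add: sum_distrib_right)
  finally show ?thesis
    unfolding sum_subtractf[symmetric] by (simp add: od algebra_simps)
qed

lemma total_degree_eq_sum:
  assumes "sandpile_graph G" "Poly_Mapping.keys a \<subseteq> nonsink G"
  shows "total_degree a = (\<Sum>x\<in>nonsink G. Poly_Mapping.lookup a x)"
  unfolding total_degree_def using assms finite_nonsink[of G]
  by (intro sum.mono_neutral_left) (auto simp: in_keys_iff)

text \<open>The second vertex of a shortest path to the sink.\<close>

lemma sink_distance_edge: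
  assumes G: "sandpile_graph G" and y: "y \<in> nonsink G" and ne: "(y, sink G) \<notin> edges G"
  obtains u where "u \<in> nonsink G" "(y, u) \<in> edges G" "sink_distance G u < sink_distance G y"
proof -
  have "(y, sink G) \<in> (edges G)\<^sup>*" using G y by (auto simp: sandpile_graph_def nonsink_def)
  then have "\<exists>k. (y, sink G) \<in> edges G ^^ k" by (simp add: rtrancl_power)
  then have d: "(y, sink G) \<in> edges G ^^ sink_distance G y"
    unfolding sink_distance_def by (rule LeastI_ex)
  moreover have "y \<noteq> sink G" using y by (simp add: nonsink_def)
  ultimately obtain k where k: "sink_distance G y = Suc k"
    by (cases "sink_distance G y") auto
  with d obtain u where u: "(y, u) \<in> edges G" "(u, sink G) \<in> edges G ^^ k"
    by (metis relpow_Suc_D2)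
  have "sink_distance G u \<le> k" unfolding sink_distance_def by (rule Least_le) (rule u(2))
  moreover have "u \<in> nonsink G"
    using u(1) ne G by (auto simp: nonsink_def sandpile_graph_def directed_multigraph_def)
  ultimately show ?thesis using that u(1) k by auto
qed

text \<open>
  The choice of ordering enters here. By the sum formula above the degree cannot rise when \<open>\<sigma>\<close> is
  fired from \<open>a'\<close>. If it stays the same, no fired vertex is adjacent to the sink; then let \<open>y\<close> be a
  fired vertex at minimal distance \<open>d\<close> from the sink. Its successor on a shortest path is not
  fired but receives sand, whereas only fired vertices, all of distance at least \<open>d\<close>, can lose
  sand. The indeterminates of smaller distance come last, so the right-most change is a gain.
\<close>

lemma firing_decreases:
  assumes G: "sandpile_graph G" and num: "sandpile_numbering G v n"
    and s: "\<sigma> \<in> configs G" and pos: "coord_le 0 \<sigma>" and nz: "\<sigma> \<noteq> 0"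
    and a: "Poly_Mapping.keys a \<subseteq> nonsink G" and a': "Poly_Mapping.keys a' \<subseteq> nonsink G"
    and diff: "\<And>x. int (Poly_Mapping.lookup a' x) - int (Poly_Mapping.lookup a x)
                 = Poly_Mapping.lookup (reduced_laplacian G \<sigma>) x"
  shows "degrevlex_less v n a a'"
proof -
  let ?N = "nonsink G"
  let ?s = "Poly_Mapping.lookup \<sigma>"
  let ?l = "Poly_Mapping.lookup (reduced_laplacian G \<sigma>)"
  have fin: "finite ?N" by (rule finite_nonsink[OF G])
  have p: "?s y \<ge> 0" for y using pos by (auto simp: coord_le_def)
  have deg: "int (total_degree a') - int (total_degree a)
      = (\<Sum>y\<in>?N. int (wt G y (sink G)) * ?s y)"
    by (simp add: total_degree_eq_sum[OF G a] total_degree_eq_sum[OF G a'] diff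
        sum_subtractf[symmetric] sum_reduced_laplacian[OF G s])
  have le: "total_degree a \<le> total_degree a'"
  proof -
    have "0 \<le> (\<Sum>y\<in>?N. int (wt G y (sink G)) * ?s y)" using p by (intro sum_nonneg) auto
    with deg show ?thesis by linarith
  qed
  show ?thesis
  proof (cases "total_degree a < total_degree a'")
    case True then show ?thesis by (simp add: degrevlex_less_def)
  next
    case False
    with le have eq: "total_degree a = total_degree a'" by simp
    with deg have "(\<Sum>y\<in>?N. int (wt G y (sink G)) * ?s y) = 0" by simp
    then have z: "\<forall>y\<in>?N. int (wt G y (sink G)) * ?s y = 0"
      using p fin by (subst (asm) sum_nonneg_eq_0_iff) auto
    let ?S = "Poly_Mapping.keys \<sigma>"
    have S: "?S \<subseteq> ?N" "?S \<noteq> {}" using s nz by (auto simp: configs_def)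
    obtain y where y: "y \<in> ?S" "\<And>x. x \<in> ?S \<Longrightarrow> sink_distance G y \<le> sink_distance G x"
      using S(2) ex_has_least_nat[of "\<lambda>x. x \<in> ?S" _ "sink_distance G"] by blast
    have yN: "y \<in> ?N" using y(1) S by auto
    have "wt G y (sink G) = 0" using z yN y(1) by (auto simp: in_keys_iff)
    then have "(y, sink G) \<notin> edges G" using G yN
      by (force simp: sandpile_graph_def directed_multigraph_def nonsink_def)
    from sink_distance_edge[OF G yN this] obtain u
      where u: "u \<in> ?N" "(y, u) \<in> edges G" "sink_distance G u < sink_distance G y" .
    (* Vertices closer to the sink than y are not fired, so they can only gain sand. *)
    have close: "?l x \<le> 0" if "sink_distance G x < sink_distance G y" for x
    proof -
      have "x \<notin> ?S" using that y(2)[of x] by auto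
      then have "?s x = 0" by (simp add: in_keys_iff)
      then show ?thesis using p by (simp add: lookup_reduced_laplacian[OF G s] sum_nonneg)
    qed
    (* The vertex u does gain sand, namely from y. *)
    have lu: "?l u \<noteq> 0"
    proof -
      have "u \<notin> ?S" using u(3) y(2)[of u] by auto
      then have su: "?s u = 0" by (simp add: in_keys_iff)
      have "wt G y u > 0" using u G by (auto simp: sandpile_graph_def directed_multigraph_def)
      moreover have "?s y > 0" using y(1) p[of y] by (simp add: in_keys_iff)
      ultimately have "0 < int (wt G y u) * ?s y" by simp
      also have "\<dots> \<le> (\<Sum>y\<in>?N. int (wt G y u) * ?s y)"
        using fin yN p by (intro member_le_sum) auto
      finally show ?thesis using su u(1) by (simp add: lookup_reduced_laplacian[OF G s])
    qed
    have bij: "bij_betw v {1..n} ?N"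
      and ord: "\<And>i j. i \<in> {1..n} \<Longrightarrow> j \<in> {1..n} \<Longrightarrow>
        sink_distance G (v j) < sink_distance G (v i) \<Longrightarrow> i < j"
      using num by (auto simp: sandpile_numbering_def)
    obtain i where i: "i \<in> {1..n}" "v i = u"
      using bij_betw_imp_surj_on[OF bij] u(1) by (metis imageE)
    (* The right-most changed position k is not left of u, so v k is also closer than y. *)
    define K where "K = {k\<in>{1..n}. ?l (v k) \<noteq> 0}"
    have K: "finite K" "i \<in> K" using i lu by (auto simp: K_def)
    define k where "k = Max K"
    have "k \<in> K" using Max_in[of K] K unfolding k_def by blast
    then have k: "k \<in> {1..n}" "?l (v k) \<noteq> 0" "i \<le> k"
      using Max_ge[OF K] by (auto simp: k_def K_def)
    have above: "?l (v j) = 0" if "j \<in> {k<..n}" for j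
    proof -
      have "j \<notin> K" using Max_ge[OF K(1), of j] that by (auto simp: k_def)
      then show ?thesis using that k(1) by (auto simp: K_def)
    qed
    have "sink_distance G (v k) \<le> sink_distance G u"
      using ord[OF k(1) i(1)] k(3) i(2) by fastforce
    then have "?l (v k) \<le> 0" using u(3) close by auto
    with k(2) have "?l (v k) < 0" by auto
    then have "Poly_Mapping.lookup a' (v k) < Poly_Mapping.lookup a (v k)"
      using diff[of "v k"] by linarith
    moreover have "\<forall>j\<in>{k<..n}. Poly_Mapping.lookup a' (v j) = Poly_Mapping.lookup a (v j)"
      using above diff by (metis eq_iff_diff_eq_0 of_nat_eq_iff)
    ultimately show ?thesis using eq k(1) by (auto simp: degrevlex_less_def)
  qed
qed

section \<open>Legal scripts\<close>

text \<open>
  Passing from \<open>\<tau>\<close> to \<open>\<tau>\<^sup>+\<close> cancels reverse firings. A vertex with \<open>\<tau> > 0\<close> still fires as often and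
  has no fewer incoming grains, so its requirement does not grow; every other vertex now does not
  fire at all and needs nothing beyond \<open>u \<ge> 0\<close>.
\<close>

lemma legal_positive_part:
  assumes G: "sandpile_graph G" and t: "\<tau> \<in> configs G"
    and u: "\<And>x. 0 \<le> u x" "\<And>x. Poly_Mapping.lookup (reduced_laplacian G \<tau>) x \<le> u x"
  shows "Poly_Mapping.lookup (reduced_laplacian G (Poly_Mapping.map (max 0) \<tau>)) x \<le> (u x :: int)"
proof -
  let ?t = "Poly_Mapping.lookup \<tau>"
  let ?l = "\<lambda>\<tau>. Poly_Mapping.lookup (reduced_laplacian G \<tau>) x"
  have c: "Poly_Mapping.map (max 0) \<tau> \<in> configs G" by (rule configs_closed(5)[OF t])
  note l = lookup_reduced_laplacian[OF G c] lookup_reduced_laplacian[OF G t] lookup_map_zero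
  show ?thesis
  proof (cases "?t x > 0")
    case True
    have "(\<Sum>y\<in>nonsink G. int (wt G y x) * ?t y) \<le> (\<Sum>y\<in>nonsink G. int (wt G y x) * max 0 (?t y))"
      by (intro sum_mono mult_left_mono) auto
    then have "?l (Poly_Mapping.map (max 0) \<tau>) \<le> ?l \<tau>" using True by (simp add: l)
    with u(2)[of x] show ?thesis by linarith
  next
    case False
    have "0 \<le> (\<Sum>y\<in>nonsink G. int (wt G y x) * max 0 (?t y))" by (intro sum_nonneg) auto
    then have "?l (Poly_Mapping.map (max 0) \<tau>) \<le> 0" using False by (simp add: l)
    with u(1)[of x] show ?thesis by linarith
  qed
qed

text \<open>
  If \<open>\<Delta> \<sigma> \<ge> 0\<close>, the script \<open>- \<sigma>\<close> is legal for the empty configuration, and so is \<open>\<tau> = (- \<sigma>)\<^sup>+\<close>. Were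
  \<open>\<tau>\<close> nonzero, firing it would lead from the exponent \<open>0\<close> to a strictly smaller one.
\<close>

lemma nonneg_if_laplacian_nonneg:
  assumes G: "sandpile_graph G" and num: "sandpile_numbering G v n" and s: "\<sigma> \<in> configs G"
    and nonneg: "coord_le 0 (reduced_laplacian G \<sigma>)"
  shows "coord_le 0 \<sigma>"
proof (rule ccontr)
  assume neg: "\<not> coord_le 0 \<sigma>"
  define \<tau> where "\<tau> = Poly_Mapping.map (max 0) (- \<sigma>)"
  have t: "\<tau> \<in> configs G" unfolding \<tau>_def by (intro configs_closed s)
  have lt: "Poly_Mapping.lookup \<tau> x = max 0 (- Poly_Mapping.lookup \<sigma> x)" for x
    by (simp add: \<tau>_def lookup_map_zero)
  have "reduced_laplacian G (- \<sigma>) = - reduced_laplacian G \<sigma>"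
    by (rule reduced_laplacian_linear)
  then have le: "Poly_Mapping.lookup (reduced_laplacian G \<tau>) x \<le> 0" for x
    unfolding \<tau>_def using nonneg
    by (intro legal_positive_part[OF G configs_closed(2)[OF s], where u = "\<lambda>_. 0"])
       (auto simp: coord_le_def)
  obtain x where "Poly_Mapping.lookup \<sigma> x < 0" using neg by (auto simp: coord_le_def not_le)
  then have "\<tau> \<noteq> 0" using lt[of x] by auto
  define a where "a = Poly_Mapping.map nat (- reduced_laplacian G \<tau>)"
  have la: "int (Poly_Mapping.lookup a x) = - Poly_Mapping.lookup (reduced_laplacian G \<tau>) x" for x
    using le[of x] by (simp add: a_def lookup_map_zero)
  have ka: "Poly_Mapping.keys a \<subseteq> nonsink G"
    by (auto simp: a_def in_keys_iff lookup_map_zero lookup_reduced_laplacian[OF G t] split: if_splits)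
  have "degrevlex_less v n a 0"
    using \<open>\<tau> \<noteq> 0\<close> ka by (intro firing_decreases[OF G num t]) (auto simp: coord_le_def lt la)
  then show False by (auto simp: degrevlex_less_def total_degree_def in_keys_iff)
qed

lemma script_in_configs:
  assumes "burning_config G b"
  shows "script G b \<in> configs G" "reduced_laplacian G (script G b) = b"
  using assms inv_into_into[of b "reduced_laplacian G" "configs G"]
    f_inv_into_f[of b "reduced_laplacian G" "configs G"]
  by (auto simp: burning_config_def laplacian_lattice_def script_def)

text \<open>
  If a vertex \<open>z\<close> is not fired by the script of \<open>b\<close>, then \<open>b\<close> at \<open>z\<close> equals minus the sand that \<open>z\<close>
  receives. Since \<open>b \<ge> 0\<close>, this is zero and no predecessor of \<open>z\<close> is fired either. Going backwards
  along a path from the support of \<open>b\<close> yields a contradiction.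
\<close>

lemma script_pos:
  assumes G: "sandpile_graph G" and num: "sandpile_numbering G v n" and b: "burning_config G b"
    and x: "x \<in> nonsink G"
  shows "0 < Poly_Mapping.lookup (script G b) x"
proof (rule ccontr)
  let ?N = "nonsink G"
  let ?s = "Poly_Mapping.lookup (script G b)"
  note s = script_in_configs[OF b]
  have b0: "0 \<le> Poly_Mapping.lookup b y" for y
    using b by (auto simp: burning_config_def coord_le_def)
  have "coord_le 0 (script G b)"
    using b by (intro nonneg_if_laplacian_nonneg[OF G num s(1)]) (auto simp: s(2) burning_config_def)
  then have p: "0 \<le> ?s y" for y by (auto simp: coord_le_def)
  have zero: "Poly_Mapping.lookup b z = 0 \<and> (\<forall>y\<in>?N. (y, z) \<in> edges G \<longrightarrow> ?s y = 0)"
    if z: "z \<in> ?N" "?s z = 0" for z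
  proof -
    have e: "Poly_Mapping.lookup b z = - (\<Sum>y\<in>?N. int (wt G y z) * ?s y)"
      using lookup_reduced_laplacian[OF G s(1), of z] z by (simp add: s(2))
    moreover have "0 \<le> (\<Sum>y\<in>?N. int (wt G y z) * ?s y)" using p by (intro sum_nonneg) auto
    ultimately have b0: "Poly_Mapping.lookup b z = 0" using b0[of z] by linarith
    then have "\<forall>y\<in>?N. int (wt G y z) * ?s y = 0"
      using e p finite_nonsink[OF G] by (subst (asm) (2) eq_commute) (simp add: sum_nonneg_eq_0_iff)
    moreover have "wt G y z > 0" if "y \<in> ?N" "(y, z) \<in> edges G" for y
      using that z G by (auto simp: sandpile_graph_def directed_multigraph_def nonsink_def)
    ultimately show ?thesis using b0 by fastforce
  qed
  assume "\<not> 0 < ?s x"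
  then have sx: "?s x = 0" using p[of x] by simp
  obtain u where u: "u \<in> Poly_Mapping.keys b" "(u, x) \<in> (edges G \<inter> ?N \<times> ?N)\<^sup>*"
    using b x by (auto simp: burning_config_def)
  from u(2) x sx have "u \<in> ?N \<and> ?s u = 0"
    by (induction rule: converse_rtrancl_induct) (use zero in auto)
  then show False using zero u(1) by (auto simp: in_keys_iff)
qed

text \<open>
  A nonnegative script that is not below the burning script can be reduced by it: the remainder
  \<open>(\<sigma> - \<sigma>\<^sub>b)\<^sup>+\<close> is nonzero, it is legal because \<open>u - \<Delta> (\<sigma> - \<sigma>\<^sub>b) = (u - \<Delta> \<sigma>) + b \<ge> 0\<close>, and it is smaller
  because \<open>\<sigma>\<^sub>b\<close> is positive everywhere. The induction is on the total number of firings.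
\<close>

lemma legal_script_below_burning_script:
  assumes G: "sandpile_graph G" and num: "sandpile_numbering G v n" and b: "burning_config G b"
    and u: "\<And>x. 0 \<le> u x"
    and s: "\<sigma> \<in> configs G" "coord_le 0 \<sigma>" "\<sigma> \<noteq> 0"
      "\<And>x. Poly_Mapping.lookup (reduced_laplacian G \<sigma>) x \<le> (u x :: int)"
  shows "\<exists>\<sigma>'\<in>configs G. coord_le 0 \<sigma>' \<and> \<sigma>' \<noteq> 0 \<and> coord_le \<sigma>' (script G b) \<and>
    (\<forall>x. Poly_Mapping.lookup (reduced_laplacian G \<sigma>') x \<le> u x)"
  using s
proof (induction "nat (\<Sum>x\<in>nonsink G. Poly_Mapping.lookup \<sigma> x)" arbitrary: \<sigma> rule: less_induct)
  case less
  let ?N = "nonsink G"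
  note sb = script_in_configs[OF b]
  have fin: "finite ?N" by (rule finite_nonsink[OF G])
  have p: "0 \<le> Poly_Mapping.lookup \<sigma> x" for x using less.prems by (auto simp: coord_le_def)
  have sp: "0 < Poly_Mapping.lookup (script G b) x" if "x \<in> ?N" for x
    by (rule script_pos[OF G num b that])
  show ?case
  proof (cases "coord_le \<sigma> (script G b)")
    case True
    then show ?thesis using less.prems by blast
  next
    case False
    define \<tau> where "\<tau> = Poly_Mapping.map (max 0) (\<sigma> - script G b)"
    have t: "\<tau> \<in> configs G" unfolding \<tau>_def by (intro configs_closed less.prems sb)
    have lt: "Poly_Mapping.lookup \<tau> x =
        max 0 (Poly_Mapping.lookup \<sigma> x - Poly_Mapping.lookup (script G b) x)" for x
      by (simp add: \<tau>_def lookup_map_zero lookup_minus)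
    have "reduced_laplacian G (\<sigma> - script G b) = reduced_laplacian G \<sigma> - b"
      using sb(2) by (simp add: reduced_laplacian_linear)
    then have "Poly_Mapping.lookup (reduced_laplacian G (\<sigma> - script G b)) x \<le> u x" for x
      using less.prems(4)[of x] b by (auto simp: lookup_minus burning_config_def coord_le_def
          intro: order_trans[rotated])
    then have legal: "Poly_Mapping.lookup (reduced_laplacian G \<tau>) x \<le> u x" for x
      unfolding \<tau>_def
      by (intro legal_positive_part[OF G] configs_closed less.prems sb u)
    have tp: "coord_le 0 \<tau>" by (auto simp: coord_le_def lt)
    have tn: "\<tau> \<noteq> 0"
    proof
      assume "\<tau> = 0"
      then have "Poly_Mapping.lookup \<sigma> x \<le> Poly_Mapping.lookup (script G b) x" for x
        using lt[of x] by (simp add: max_def split: if_splits)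
      with False show False by (simp add: coord_le_def)
    qed
    obtain x where x: "x \<in> Poly_Mapping.keys \<sigma>"
      using less.prems(3) by (metis ex_in_conv keys_eq_empty)
    then have "(\<Sum>x\<in>?N. Poly_Mapping.lookup \<tau> x) < (\<Sum>x\<in>?N. Poly_Mapping.lookup \<sigma> x)"
    proof (intro sum_strict_mono_ex1 fin ballI bexI)
      show xN: "x \<in> ?N" using x less.prems(1) by (auto simp: configs_def)
      show "Poly_Mapping.lookup \<tau> x < Poly_Mapping.lookup \<sigma> x"
        using sp[OF xN] p[of x] x by (auto simp: lt in_keys_iff)
      show "Poly_Mapping.lookup \<tau> y \<le> Poly_Mapping.lookup \<sigma> y" if "y \<in> ?N" for y
        using sp[OF that] p[of y] by (auto simp: lt)
    qed
    moreover have "0 \<le> (\<Sum>x\<in>?N. Poly_Mapping.lookup \<tau> x)" by (intro sum_nonneg) (simp add: lt)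
    ultimately show ?thesis using less.hyps[OF _ t tp tn legal] by auto
  qed
qed

section \<open>Coefficients of elements of the toppling ideal\<close>

lemma coefficient_sum_superset:
  fixes f :: "'v mpol"
  assumes "finite A" "Poly_Mapping.keys f \<subseteq> A"
  shows "(\<Sum>m\<in>Poly_Mapping.keys f \<inter> C. Poly_Mapping.lookup f m)
    = (\<Sum>m\<in>A \<inter> C. Poly_Mapping.lookup f m)"
  using assms by (intro sum.mono_neutral_left) (auto simp: in_keys_iff)

text \<open>
  Both exponents of a generator lie in the nonsink indeterminates, and both or none lie in a set
  \<open>C\<close> that is a union of classes modulo the lattice. So the sum of the coefficients over \<open>C\<close>, which
  is linear in the polynomial, vanishes on the generators.
\<close>

lemma toppling_ideal_class_sum:
  assumes f: "f \<in> toppling_ideal G"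
    and C: "\<And>u w. Poly_Mapping.map int u - Poly_Mapping.map int w \<in> laplacian_lattice G \<Longrightarrow>
              u \<in> C \<longleftrightarrow> w \<in> C"
  shows "(\<forall>m\<in>Poly_Mapping.keys f. Poly_Mapping.keys m \<subseteq> nonsink G) \<and>
    (\<Sum>m\<in>Poly_Mapping.keys f \<inter> C. Poly_Mapping.lookup f m) = 0"
  using f unfolding toppling_ideal_def
proof (induction rule: mpol.span_induct)
  case base
  show ?case
  proof (rule mpol.subspaceI, goal_cases)
    case 1
    show ?case by simp
  next
    case (2 f g)
    let ?A = "Poly_Mapping.keys f \<union> Poly_Mapping.keys g"
    have fin: "finite ?A" by simp
    have sub: "Poly_Mapping.keys (f + g) \<subseteq> ?A" by (rule Poly_Mapping.keys_add)
    have "(\<Sum>m\<in>Poly_Mapping.keys (f + g) \<inter> C. Poly_Mapping.lookup (f + g) m) =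
        (\<Sum>m\<in>Poly_Mapping.keys f \<inter> C. Poly_Mapping.lookup f m) +
        (\<Sum>m\<in>Poly_Mapping.keys g \<inter> C. Poly_Mapping.lookup g m)"
      unfolding coefficient_sum_superset[OF fin sub]
        coefficient_sum_superset[of ?A f, OF fin Un_upper1]
        coefficient_sum_superset[of ?A g, OF fin Un_upper2]
      by (simp add: lookup_add sum.distrib)
    with 2 sub show ?case by auto
  next
    case (3 c f)
    let ?g = "Poly_Mapping.map ((*) c) f"
    have sub: "Poly_Mapping.keys ?g \<subseteq> Poly_Mapping.keys f" by (rule keys_map_subset)
    have "(\<Sum>m\<in>Poly_Mapping.keys ?g \<inter> C. Poly_Mapping.lookup ?g m) =
        c * (\<Sum>m\<in>Poly_Mapping.keys f \<inter> C. Poly_Mapping.lookup f m)"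
      unfolding coefficient_sum_superset[OF finite_keys sub]
      by (simp add: lookup_map_zero sum_distrib_left)
    with 3 sub show ?case by auto
  qed
next
  case (step f)
  then obtain u w where f: "f = xpow u - xpow w" and u: "Poly_Mapping.keys u \<subseteq> nonsink G"
    and w: "Poly_Mapping.keys w \<subseteq> nonsink G"
    and l: "Poly_Mapping.map int u - Poly_Mapping.map int w \<in> laplacian_lattice G" by auto
  have sub: "Poly_Mapping.keys f \<subseteq> {u, w}"
    by (auto simp: f xpow_def in_keys_iff lookup_minus lookup_single when_def split: if_splits)
  have "(\<Sum>m\<in>Poly_Mapping.keys f \<inter> C. Poly_Mapping.lookup f m)
      = (\<Sum>m\<in>{u, w} \<inter> C. Poly_Mapping.lookup f m)"
    using sub by (intro coefficient_sum_superset) auto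
  also have "\<dots> = 0"
    using C[OF l] by (cases "u = w"; cases "u \<in> C")
      (auto simp: f xpow_def lookup_minus lookup_single when_def Int_insert_left)
  finally show ?case using sub u w by auto
qed

text \<open>A single nonzero coefficient in the class of \<open>m\<close> would make the sum over that class nonzero.\<close>

lemma toppling_ideal_equivalent_exponent:
  assumes f: "f \<in> toppling_ideal G" and m: "m \<in> Poly_Mapping.keys f"
  obtains m' where "m' \<in> Poly_Mapping.keys f" "m' \<noteq> m"
    "Poly_Mapping.map int m - Poly_Mapping.map int m' \<in> laplacian_lattice G"
proof -
  let ?i = "Poly_Mapping.map int"
  define C where "C = {m'. ?i m - ?i m' \<in> laplacian_lattice G}"
  have "u \<in> C \<longleftrightarrow> w \<in> C" if "?i u - ?i w \<in> laplacian_lattice G" for u w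
    using lattice_closed(3)[OF _ that, of "?i m - ?i u"]
      lattice_closed(3)[OF _ lattice_closed(2)[OF that], of "?i m - ?i w"]
    by (auto simp: C_def)
  then have "(\<Sum>m\<in>Poly_Mapping.keys f \<inter> C. Poly_Mapping.lookup f m) = 0"
    using toppling_ideal_class_sum[OF f] by blast
  moreover have "(\<Sum>m\<in>{m}. Poly_Mapping.lookup f m) \<noteq> 0" using m by (simp add: in_keys_iff)
  moreover have "m \<in> C" by (simp add: C_def lattice_closed)
  ultimately have "Poly_Mapping.keys f \<inter> C \<noteq> {m}" by metis
  with m \<open>m \<in> C\<close> obtain m' where "m' \<in> Poly_Mapping.keys f" "m' \<in> C" "m' \<noteq> m" by blast
  then show ?thesis using that by (simp add: C_def)
qed

section \<open>Toppling binomials\<close>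

lemma toppling_binomial_in_ideal:
  assumes G: "sandpile_graph G" and s: "\<sigma> \<in> configs G"
  shows "toppling_binomial G \<sigma> \<in> toppling_ideal G"
proof -
  let ?l = "reduced_laplacian G \<sigma>"
  let ?u = "Poly_Mapping.map nat ?l" and ?w = "Poly_Mapping.map nat (- ?l)"
  have "Poly_Mapping.map int ?u - Poly_Mapping.map int ?w = ?l"
    by (rule poly_mapping_eqI) (simp add: lookup_minus lookup_map_zero)
  moreover have "Poly_Mapping.keys ?l \<subseteq> nonsink G"
    by (auto simp: in_keys_iff lookup_reduced_laplacian[OF G s] split: if_splits)
  ultimately have "xpow ?u - xpow ?w \<in> toppling_ideal G"
    unfolding toppling_ideal_def using s keys_map_subset[of nat ?l] keys_map_subset[of nat "- ?l"]
    by (intro mpol.span_base CollectI exI[of _ ?u] exI[of _ ?w]) (auto simp: laplacian_lattice_def)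
  then show ?thesis by (simp add: toppling_binomial_def Let_def)
qed

lemma leading_term_toppling_binomial:
  assumes G: "sandpile_graph G" and num: "sandpile_numbering G v n"
    and s: "\<sigma> \<in> configs G" "coord_le 0 \<sigma>" "\<sigma> \<noteq> 0"
  shows "toppling_binomial G \<sigma> \<noteq> 0"
    and "leading_term (degrevlex_less v n) (toppling_binomial G \<sigma>)
      = xpow (Poly_Mapping.map nat (reduced_laplacian G \<sigma>))"
proof -
  let ?l = "reduced_laplacian G \<sigma>"
  let ?u = "Poly_Mapping.map nat ?l" and ?w = "Poly_Mapping.map nat (- ?l)"
  have "Poly_Mapping.keys ?l \<subseteq> nonsink G"
    by (auto simp: in_keys_iff lookup_reduced_laplacian[OF G s(1)] split: if_splits)
  then have less: "degrevlex_less v n ?w ?u"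
    using keys_map_subset[of nat ?l] keys_map_subset[of nat "- ?l"]
    by (intro firing_decreases[OF G num s]) (auto simp: lookup_map_zero)
  then have ne: "?u \<noteq> ?w" using degrevlex_less_asym by metis
  have lu: "Poly_Mapping.lookup (toppling_binomial G \<sigma>) ?u = 1"
    using ne by (simp add: toppling_binomial_def Let_def xpow_def lookup_minus lookup_single)
  then show "toppling_binomial G \<sigma> \<noteq> 0" by auto
  have "Poly_Mapping.keys (toppling_binomial G \<sigma>) \<subseteq> {?u, ?w}"
    by (auto simp: toppling_binomial_def Let_def xpow_def in_keys_iff lookup_minus lookup_single
        when_def split: if_splits)
  then have "leading_expo (degrevlex_less v n) (toppling_binomial G \<sigma>) = ?u"
    using less lu by (intro leading_expo_eqI) (auto simp: in_keys_iff)
  then show "leading_term (degrevlex_less v n) (toppling_binomial G \<sigma>) = xpow ?u"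
    by (simp add: leading_term_def lu xpow_def)
qed

lemma xpow_dvd_single:
  assumes "\<And>x. Poly_Mapping.lookup e x \<le> Poly_Mapping.lookup m x"
  shows "xpow e dvd Poly_Mapping.single m c"
proof
  have "e + (m - e) = m"
    using assms by (intro poly_mapping_eqI) (simp add: lookup_add lookup_minus)
  then show "Poly_Mapping.single m c = xpow e * Poly_Mapping.single (m - e) c"
    by (simp add: xpow_def mult_single)
qed

lemma finite_scripts_between:
  "finite {\<sigma> :: 'v \<Rightarrow>\<^sub>0 int. coord_le 0 \<sigma> \<and> coord_le \<sigma> s}"
proof -
  let ?S = "{\<sigma> :: 'v \<Rightarrow>\<^sub>0 int. coord_le 0 \<sigma> \<and> coord_le \<sigma> s}"
  let ?K = "Poly_Mapping.keys s"
  let ?B = "\<Union>x\<in>?K. {0..Poly_Mapping.lookup s x}"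
  have "Poly_Mapping.lookup ` ?S \<subseteq> {f. \<forall>x. (x \<in> ?K \<longrightarrow> f x \<in> ?B) \<and> (x \<notin> ?K \<longrightarrow> f x = 0)}"
    by (auto simp: coord_le_def in_keys_iff intro: antisym) (metis order.antisym)
  moreover have "finite {f. \<forall>x. (x \<in> ?K \<longrightarrow> f x \<in> ?B) \<and> (x \<notin> ?K \<longrightarrow> f x = (0::int))}"
    by (rule finite_set_of_finite_funs) auto
  ultimately have "finite (Poly_Mapping.lookup ` ?S)" by (rule finite_subset)
  then show ?thesis
    by (rule finite_imageD) (auto intro!: inj_onI poly_mapping_eqI)
qed

theorem theorem5p11:
  fixes G :: "'v sandpile" and v :: "nat \<Rightarrow> 'v" and n :: nat and b :: "'v \<Rightarrow>\<^sub>0 int"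
  assumes "sandpile_graph G"
    and "sandpile_numbering G v n"
    and "burning_config G b"
  shows "groebner_basis (degrevlex_less v n)
           {toppling_binomial G \<sigma> | \<sigma>. \<sigma> \<in> configs G \<and> coord_le 0 \<sigma> \<and> coord_le \<sigma> (script G b)}
           (toppling_ideal G)"
    (is "groebner_basis ?lt ?\<Gamma> ?I")
  unfolding groebner_basis_def
proof (intro conjI ballI impI)
  note G = assms(1) and num = assms(2) and b = assms(3)
  have "?\<Gamma> \<subseteq> toppling_binomial G ` {\<sigma>. coord_le 0 \<sigma> \<and> coord_le \<sigma> (script G b)}" by auto
  then show "finite ?\<Gamma>" by (rule finite_subset) (intro finite_imageI finite_scripts_between)
  show "?\<Gamma> \<subseteq> ?I" using toppling_binomial_in_ideal[OF G] by auto
  fix f assume f: "f \<in> ?I" "f \<noteq> 0"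
  have bij: "bij_betw v {1..n} (nonsink G)" using num by (simp add: sandpile_numbering_def)
  have supp: "Poly_Mapping.keys m \<subseteq> nonsink G" if "m \<in> Poly_Mapping.keys f" for m
    using toppling_ideal_class_sum[OF f(1), of UNIV] that by blast
  define m where "m = leading_expo ?lt f"
  have m: "m \<in> Poly_Mapping.keys f"
    and less: "\<And>m'. m' \<in> Poly_Mapping.keys f \<Longrightarrow> m' \<noteq> m \<Longrightarrow> ?lt m' m"
    using leading_expo_max[OF bij f(2) supp] by (auto simp: m_def)
  obtain m' where m': "m' \<in> Poly_Mapping.keys f" "m' \<noteq> m"
    and lat: "Poly_Mapping.map int m - Poly_Mapping.map int m' \<in> laplacian_lattice G"
    using toppling_ideal_equivalent_exponent[OF f(1) m] .
  from lat obtain \<tau> where t: "\<tau> \<in> configs G"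
    and dt: "Poly_Mapping.map int m - Poly_Mapping.map int m' = reduced_laplacian G \<tau>"
    by (auto simp: laplacian_lattice_def)
  have lt: "Poly_Mapping.lookup (reduced_laplacian G \<tau>) x =
      int (Poly_Mapping.lookup m x) - int (Poly_Mapping.lookup m' x)" for x
    by (simp add: dt[symmetric] lookup_minus lookup_map_zero)
  define \<sigma> where "\<sigma> = Poly_Mapping.map (max 0) \<tau>"
  have s: "\<sigma> \<in> configs G" unfolding \<sigma>_def by (intro configs_closed t)
  have sp: "coord_le 0 \<sigma>" by (simp add: \<sigma>_def coord_le_def lookup_map_zero)
  have legal: "Poly_Mapping.lookup (reduced_laplacian G \<sigma>) x \<le> int (Poly_Mapping.lookup m x)" for x
    unfolding \<sigma>_def by (rule legal_positive_part[OF G t]) (auto simp: lt)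
  (* Otherwise m would be obtained from m' by firing, against m being the leading exponent. *)
  have "\<sigma> \<noteq> 0"
  proof
    assume "\<sigma> = 0"
    then have tneg: "Poly_Mapping.lookup \<tau> x \<le> 0" for x
      using lookup_map_zero[of "max 0" \<tau> x] by (simp add: \<sigma>_def)
    have tn: "- \<tau> \<noteq> 0"
    proof
      assume "- \<tau> = 0"
      then have "reduced_laplacian G \<tau> = 0" by (simp add: reduced_laplacian_def)
      then have "m = m'" using lt by (intro poly_mapping_eqI) simp
      with m' show False by simp
    qed
    have "reduced_laplacian G (- \<tau>) = - reduced_laplacian G \<tau>"
      by (rule reduced_laplacian_linear)
    then have "?lt m m'" using tneg supp m m'(1)
      by (intro firing_decreases[OF G num configs_closed(2)[OF t] _ tn])
         (auto simp: coord_le_def lt)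
    with less[OF m'] degrevlex_less_asym show False by blast
  qed
  with legal_script_below_burning_script[OF G num b _ s sp _ legal]
  obtain \<rho> where r: "\<rho> \<in> configs G" "coord_le 0 \<rho>" "\<rho> \<noteq> 0" "coord_le \<rho> (script G b)"
    and rl: "\<And>x. Poly_Mapping.lookup (reduced_laplacian G \<rho>) x \<le> int (Poly_Mapping.lookup m x)"
    by auto
  have "Poly_Mapping.lookup (Poly_Mapping.map nat (reduced_laplacian G \<rho>)) x
      \<le> Poly_Mapping.lookup m x" for x
    using rl[of x] by (simp add: lookup_map_zero)
  then have "leading_term ?lt (toppling_binomial G \<rho>) dvd leading_term ?lt f"
    unfolding leading_term_toppling_binomial(2)[OF G num r(1-3)]
    by (subst leading_term_def) (rule xpow_dvd_single, simp add: m_def)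
  with r leading_term_toppling_binomial(1)[OF G num r(1-3)]
  show "\<exists>g\<in>?\<Gamma>. g \<noteq> 0 \<and> leading_term ?lt g dvd leading_term ?lt f" by blast
qed

end
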